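(* As $x\to\infty$ ($x$ real), one has the asymptotic series $$\Gamma(x+1)\sim\sqrt{2\pi}\,x^{x+1/2}\exp\biggl(\frac{1}{12}\psi'\biggl(x+\frac{1}{2}\biggr)-x+\frac{1}{240}\frac{1}{x^{3}}-\frac{11}{6720}\frac{1}{x^{5}}+\frac{107}{80640}\frac{1}{x^{7}}-\frac{2911}{1520640}\frac{1}{x^{9}}+\cdots\biggr).$$ That is, there is a sequence of real numbers $(c_k)_{k\ge1}$ with $$c_1=\frac{1}{240},\quad c_2=-\frac{11}{6720},\quad c_3=\frac{107}{80640},\quad c_4=-\frac{2911}{1520640},$$ such that for every integer $N\ge1$, as $x\to\infty$, $$\ln\Gamma(x+1)-\biggl(x+\frac12\biggr)\ln x+x-\frac12\ln(2\pi)-\frac{1}{12}\psi'\biggl(x+\frac12\biggr)=\sum_{k=1}^{N}\frac{c_k}{x^{2k+1}}+O\biggl(\frac{1}{x^{2N+3}}\biggr).$$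
   Context: $\Gamma$ is Euler's gamma function, $\Gamma(x)=\int_0^\infty t^{x-1}e^{-t}\,dt$ for $x>0$; $\psi(x)=\frac{d}{dx}\ln\Gamma(x)=\Gamma'(x)/\Gamma(x)$ is the di-gamma function, and its derivative $\psi'(x)$, $x>0$, is the tri-gamma function. *)

theory Defs
  imports "HOL-Analysis.Analysis" "HOL-Library.Landau_Symbols"
begin

end

theory Submission
  imports Defs "HOL-Real_Asymp.Real_Asymp"
begin

text \<open>
  Write \<open>F x\<close> for the left-hand side of the expansion. The functional equations of \<open>\<Gamma>\<close> and of the
  trigamma function make \<open>F x - F (x + 1)\<close> elementary, and in terms of \<open>u = 1 / (2 * x + 1)\<close> both this
  difference and those of the powers \<open>1 / x ^ (2 * k + 1)\<close> are power series in \<open>u\<^sup>2\<close>, because they are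
  invariant under the reflection of \<open>x\<close> at \<open>- 1 / 2\<close>. Matching coefficients determines the \<open>c k\<close>
  recursively. The difference of the remainder after \<open>N\<close> terms is then \<open>O(u ^ (2 * N + 4))\<close>, hence
  dominated by the difference of \<open>1 / x ^ (2 * N + 3)\<close>. Since the remainder vanishes along \<open>x + n\<close>
  (Stirling's formula), telescoping bounds it by a multiple of \<open>1 / x ^ (2 * N + 3)\<close>.
\<close>

section \<open>Power series in \<open>u = 1 / (2 * x + 1)\<close>\<close>

text \<open>The binomial series of \<open>(1 - z)\<close> to the power \<open>- (p + 1)\<close>,
  multiplied by \<open>z ^ p\<close>. After the shift by \<open>p\<close> no initial terms are
  missing, because \<open>n choose p\<close> vanishes for \<open>n < p\<close>.\<close>

lemma sums_choose_power:
  fixes z :: real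
  assumes "\<bar>z\<bar> < 1"
  shows "(\<lambda>n. real (n choose p) * z ^ n) sums (z ^ p / (1 - z) ^ (p + 1))"
proof -
  have "(\<lambda>j. ((- real (p + 1)) gchoose j) * (- z) ^ j) sums (1 + (- z)) powr (- real (p + 1))"
    by (rule gen_binomial_real) (use assms in auto)
  moreover have "((- real (p + 1)) gchoose j) * (- z) ^ j = real ((j + p) choose p) * z ^ j" for j
  proof -
    have "(- real (p + 1)) gchoose j = (- 1) ^ j * (real (j + p) gchoose j)"
      by (subst gbinomial_minus) (simp add: add_ac)
    also have "real (j + p) gchoose j = real ((j + p) choose p)"
      by (metis add_diff_cancel_left' binomial_gbinomial binomial_symmetric le_add1)
    finally show ?thesis
      by (simp add: power_minus[of z])
  qed
  moreover have "(1 + (- z)) powr (- real (p + 1)) = 1 / (1 - z) ^ (p + 1)"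
    using assms by (simp add: powr_minus_divide powr_realpow del: of_nat_add of_nat_Suc)
  ultimately have "(\<lambda>j. real ((j + p) choose p) * z ^ j) sums (1 / (1 - z) ^ (p + 1))"
    by simp
  from sums_mult[OF this, of "z ^ p"]
  have "(\<lambda>j. real ((j + p) choose p) * z ^ (j + p)) sums (z ^ p / (1 - z) ^ (p + 1))"
    by (simp add: power_add mult_ac)
  moreover have "(\<Sum>i<p. real (i choose p) * z ^ i) = 0"
    by (intro sum.neutral) simp
  ultimately show ?thesis
    by (subst (asm) sums_iff_shift) simp
qed

text \<open>With \<open>u = 1 / (2 * x + 1)\<close> one has \<open>1 / x = 2 * u / (1 - u)\<close>
  and \<open>1 / (x + 1) = 2 * u / (1 + u)\<close>, so the two powers come from one binomial series
  at \<open>u\<close> and at \<open>- u\<close>. In the difference the even powers cancel and the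
  odd ones double.\<close>

lemma sums_diff_inverse_odd_power:
  fixes x :: real
  assumes "x > 0"
  shows "(\<lambda>i. 4 ^ (k + 1) * real ((2 * i + 1) choose (2 * k)) * (1 / (2 * x + 1)\<^sup>2) ^ (i + 1))
           sums (1 / x ^ (2 * k + 1) - 1 / (x + 1) ^ (2 * k + 1))"
proof -
  define u where "u = 1 / (2 * x + 1)"
  define f where "f = (\<lambda>n. real (n choose (2 * k)) * u ^ n - real (n choose (2 * k)) * (- u) ^ n)"
  have u: "0 < u" "\<bar>u\<bar> < 1" using assms by (auto simp: u_def)
  have *: "f sums (u ^ (2 * k) / (1 - u) ^ (2 * k + 1) - u ^ (2 * k) / (1 + u) ^ (2 * k + 1))"
    using sums_diff[OF sums_choose_power[of u "2 * k"] sums_choose_power[of "- u" "2 * k"]] u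
    by (simp add: f_def)
  have "(\<lambda>i. f (2 * i + 1)) sums (u ^ (2 * k) / (1 - u) ^ (2 * k + 1) - u ^ (2 * k) / (1 + u) ^ (2 * k + 1))"
  proof (subst sums_mono_reindex)
    show "strict_mono (\<lambda>i::nat. 2 * i + 1)" by (auto simp: strict_mono_def)
    fix n :: nat assume "n \<notin> range (\<lambda>i. 2 * i + 1)"
    then have "even n" by (metis oddE rangeI)
    then show "f n = 0" by (simp add: f_def)
  qed (fact *)
  \<comment> \<open>This factor completes \<open>u ^ (2 * k)\<close> to
    \<open>(2 * u) ^ (2 * k + 1)\<close>. Its extra \<open>u\<close> also makes the odd exponents
    even, hence powers of \<open>u\<^sup>2\<close>.\<close>
  from sums_mult[OF this, of "u * 2 ^ (2 * k + 1)"]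
  have "(\<lambda>i. u * 2 ^ (2 * k + 1) * f (2 * i + 1)) sums
     ((2 * u / (1 - u)) ^ (2 * k + 1) - (2 * u / (1 + u)) ^ (2 * k + 1))"
    by (simp add: power_divide power_mult_distrib algebra_simps)
  moreover have "1 - u = 2 * x * u" "1 + u = 2 * (x + 1) * u"
    using assms by (simp_all add: u_def field_simps)
  then have "2 * u / (1 - u) = 1 / x" "2 * u / (1 + u) = 1 / (x + 1)"
    using u by (simp_all del: distrib_left_numeral distrib_right_numeral)
  moreover have "u * 2 ^ (2 * k + 1) * f (2 * i + 1) =
      4 ^ (k + 1) * real ((2 * i + 1) choose (2 * k)) * (1 / (2 * x + 1)\<^sup>2) ^ (i + 1)" for i
  proof -
    have "f (2 * i + 1) = 2 * (real ((2 * i + 1) choose (2 * k)) * u ^ (2 * i + 1))"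
      by (simp add: f_def)
    moreover have "(1 / (2 * x + 1)\<^sup>2) ^ (i + 1) = u * u ^ (2 * i + 1)"
    proof -
      have "1 / (2 * x + 1)\<^sup>2 = u\<^sup>2" by (simp add: u_def power_one_over)
      then show ?thesis by (simp only: power_mult[symmetric]) simp
    qed
    moreover have "(4::real) ^ (k + 1) = 2 * 2 ^ (2 * k + 1)"
      by (simp add: power_mult)
    ultimately show ?thesis by (simp only: mult_ac)
  qed
  ultimately show ?thesis by (simp add: power_one_over)
qed

text \<open>Since \<open>(x + 1) / x = (1 + u) / (1 - u)\<close>, the logarithm is twice the artanh
  series in \<open>u\<close>. The prefactor \<open>x + 1 / 2\<close> equals
  \<open>1 / (2 * u)\<close>, and the \<open>- 1\<close> removes the constant term.\<close>

lemma sums_stirling_diff: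
  fixes x :: real
  assumes "x > 0"
  shows "(\<lambda>i. (1 / real (2 * i + 3)) * (1 / (2 * x + 1)\<^sup>2) ^ (i + 1))
           sums ((x + 1 / 2) * (ln (x + 1) - ln x) - 1)"
proof -
  define u where "u = 1 / (2 * x + 1)"
  have u: "0 < u" using assms by (auto simp: u_def)
  have "((x + 1) / x - 1) / ((x + 1) / x + 1) = u"
    using assms by (simp add: u_def field_simps)
  then have "(\<lambda>n. 2 * u ^ (2 * n + 1) / real (2 * n + 1)) sums ln ((x + 1) / x)"
    using ln_series_quadratic[of "(x + 1) / x"] assms by simp
  from sums_divide[OF this, of "2 * u"]
  have "(\<lambda>n. 2 * u ^ (2 * n + 1) / real (2 * n + 1) / (2 * u)) sums (ln ((x + 1) / x) / (2 * u))" .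
  also have "(\<lambda>n. 2 * u ^ (2 * n + 1) / real (2 * n + 1) / (2 * u)) = (\<lambda>n. (1 / real (2 * n + 1)) * (u\<^sup>2) ^ n)"
    using u by (intro ext) (simp add: power_mult)
  also have "ln ((x + 1) / x) / (2 * u) = ((x + 1 / 2) * (ln (x + 1) - ln x) - 1)
       + (\<Sum>n<1. (1 / real (2 * n + 1)) * (u\<^sup>2) ^ n)"
    using assms by (simp add: u_def ln_div field_simps)
  finally have "(\<lambda>n. (1 / real (2 * (n + 1) + 1)) * (u\<^sup>2) ^ (n + 1)) sums
      ((x + 1 / 2) * (ln (x + 1) - ln x) - 1)"
    by (subst sums_iff_shift)
  then show ?thesis by (simp add: u_def power_one_over add_ac)
qed

section \<open>Power series with vanishing initial coefficients; comparison by telescoping\<close>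

text \<open>For \<open>n \<ge> m\<close> and \<open>w \<le> s\<close> one has
  \<open>(w / s) ^ n \<le> (w / s) ^ m\<close>, so \<open>w ^ m\<close> factors out of the series.
  What is left converges absolutely, as \<open>s\<close> lies strictly inside the disc of
  convergence.\<close>

lemma powser_tail_bound:
  fixes a :: "nat \<Rightarrow> real"
  assumes "summable (\<lambda>n. a n * r ^ n)" "0 < s" "s < r" "\<And>n. n < m \<Longrightarrow> a n = 0"
  obtains K where "K \<ge> 0" "\<And>w. 0 \<le> w \<Longrightarrow> w \<le> s \<Longrightarrow> \<bar>\<Sum>n. a n * w ^ n\<bar> \<le> K * w ^ m"
proof -
  have sm: "summable (\<lambda>n. norm (a n * s ^ n))"
    using assms by (intro powser_insidea[OF assms(1)]) auto
  define K where "K = (\<Sum>n. norm (a n * s ^ n)) / s ^ m"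
  have "\<bar>\<Sum>n. a n * w ^ n\<bar> \<le> K * w ^ m" if w: "0 \<le> w" "w \<le> s" for w
  proof -
    have *: "norm (a n * w ^ n) \<le> norm (a n * s ^ n) * (w / s) ^ m" for n
    proof (cases "n < m")
      case False
      have "w ^ n = s ^ n * (w / s) ^ n" using assms by (simp add: power_divide)
      also have "(w / s) ^ n \<le> (w / s) ^ m"
        using w assms False by (intro power_decreasing) auto
      finally have "w ^ n \<le> s ^ n * (w / s) ^ m" using assms by simp
      then show ?thesis
        using w assms by (simp add: abs_mult mult.assoc mult_left_mono)
    qed (simp add: assms)
    have "norm (\<Sum>n. a n * w ^ n) \<le> (\<Sum>n. norm (a n * s ^ n) * (w / s) ^ m)"
      by (rule norm_suminf_le[OF * summable_mult2[OF sm]])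
    also have "\<dots> = K * w ^ m"
      by (subst suminf_mult2[OF sm, symmetric]) (simp add: K_def power_divide)
    finally show ?thesis by simp
  qed
  moreover have "K \<ge> 0"
    unfolding K_def using assms by (intro divide_nonneg_nonneg suminf_nonneg sm) auto
  ultimately show ?thesis using that by blast
qed

text \<open>Adding the bounds at \<open>x\<close>, \<open>x + 1\<close>, ... telescopes on both
  sides. The far end of \<open>V\<close> is dropped by nonnegativity, that of \<open>R\<close>
  disappears in the limit.\<close>

lemma abs_le_of_telescoping_bound:
  fixes R V :: "real \<Rightarrow> real"
  assumes diff: "\<And>y. y \<ge> x \<Longrightarrow> \<bar>R y - R (y + 1)\<bar> \<le> K * (V y - V (y + 1))"
    and nonneg: "\<And>y. y \<ge> x \<Longrightarrow> V y \<ge> 0" and "K \<ge> 0"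
    and lim: "(\<lambda>n. R (x + real n)) \<longlonglongrightarrow> 0"
  shows "\<bar>R x\<bar> \<le> K * V x"
proof -
  have *: "\<bar>R x - R (x + real n)\<bar> \<le> K * (V x - V (x + real n))" for n
  proof (induction n)
    case (Suc n)
    have "\<bar>R (x + real n) - R (x + real n + 1)\<bar> \<le> K * (V (x + real n) - V (x + real n + 1))"
      by (rule diff) simp
    with Suc show ?case by (simp add: algebra_simps)
  qed simp
  have "\<bar>R x - R (x + real n)\<bar> \<le> K * V x" for n
  proof -
    have "K * (V x - V (x + real n)) \<le> K * V x"
      using nonneg[of "x + real n"] \<open>K \<ge> 0\<close> by (intro mult_left_mono) auto
    with *[of n] show ?thesis by linarith
  qed
  moreover have "(\<lambda>n. \<bar>R x - R (x + real n)\<bar>) \<longlonglongrightarrow> \<bar>R x - 0\<bar>"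
    by (intro tendsto_intros lim)
  ultimately show ?thesis by (intro LIMSEQ_le_const2) auto
qed

section \<open>Stirling's formula\<close>

text \<open>The constant \<open>ln (2 * pi) / 2\<close> is not subtracted here; it is identified
  below as the limit along the integers.\<close>

definition stirling_rem :: "real \<Rightarrow> real" where
  "stirling_rem x = ln (Gamma (x + 1)) - (x + 1 / 2) * ln x + x"

lemma stirling_rem_diff:
  assumes "x > 0"
  shows "stirling_rem x - stirling_rem (x + 1) = (x + 1 / 2) * (ln (x + 1) - ln x) - 1"
proof -
  have "Gamma (x + 1 + 1) = (x + 1) * Gamma (x + 1)"
    using assms by (intro Gamma_plus1) (auto elim!: nonpos_Ints_cases)
  then have "ln (Gamma (x + 1 + 1)) = ln (x + 1) + ln (Gamma (x + 1))"
    using assms by (simp add: ln_mult_pos)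
  then show ?thesis by (simp add: stirling_rem_def algebra_simps)
qed

lemma Gamma_legendre_duplication_real:
  fixes x :: real
  assumes "x > 0"
  shows "Gamma x * Gamma (x + 1 / 2) = exp ((1 - 2 * x) * ln 2) * sqrt pi * Gamma (2 * x)"
proof -
  have "complex_of_real (Gamma x * Gamma (x + 1 / 2)) =
      Gamma (of_real x) * Gamma (of_real x + 1 / 2)"
    by (simp flip: Gamma_complex_of_real)
  also have "\<dots> = exp ((1 - 2 * of_real x) * of_real (ln 2)) * of_real (sqrt pi) * Gamma (2 * of_real x)"
  proof (rule Gamma_legendre_duplication)
    show "complex_of_real x \<notin> \<int>\<^sub>\<le>\<^sub>0" using assms by (auto elim!: nonpos_Ints_cases simp: complex_eq_iff)
    show "complex_of_real x + 1 / 2 \<notin> \<int>\<^sub>\<le>\<^sub>0" using assms by (auto elim!: nonpos_Ints_cases simp: complex_eq_iff)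
  qed
  also have "\<dots> = complex_of_real (exp ((1 - 2 * x) * ln 2) * sqrt pi * Gamma (2 * x))"
    by (simp flip: Gamma_complex_of_real exp_of_real)
  finally show ?thesis by (simp only: of_real_eq_iff)
qed

text \<open>Euler's limit for \<open>Gamma z\<close> in logarithmic form: the Pochhammer symbol is
  \<open>Gamma (z + n) / Gamma z\<close> and the factorial is \<open>Gamma n\<close>.\<close>

lemma ln_Gamma_shift_LIMSEQ:
  fixes z :: real
  assumes "z > 0"
  shows "(\<lambda>n. ln (Gamma (z + real n)) - ln (Gamma (real n)) - z * ln (real n)) \<longlonglongrightarrow> 0"
proof -
  have z: "z \<notin> \<int>\<^sub>\<le>\<^sub>0" using assms by (auto elim!: nonpos_Ints_cases)
  have "(\<lambda>n. ln (Gamma_series' z n)) \<longlonglongrightarrow> ln (Gamma z)"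
    using assms by (intro tendsto_ln Gamma_series'_LIMSEQ) (auto simp: less_imp_neq[symmetric])
  then have "(\<lambda>n. ln (Gamma z) - ln (Gamma_series' z n)) \<longlonglongrightarrow> ln (Gamma z) - ln (Gamma z)"
    by (rule tendsto_diff[OF tendsto_const])
  moreover have "eventually (\<lambda>n. ln (Gamma z) - ln (Gamma_series' z n) =
     ln (Gamma (z + real n)) - ln (Gamma (real n)) - z * ln (real n)) at_top"
    using eventually_gt_at_top[of 0]
  proof eventually_elim
    case (elim n)
    have "Gamma_series' z n = Gamma (real n) * exp (z * ln (real n)) * Gamma z / Gamma (z + real n)"
      using elim z Gamma_fact[of "n - 1", where ?'a = real]
      by (simp add: Gamma_series'_def pochhammer_Gamma of_nat_diff)
    moreover have "Gamma z > 0" "Gamma (real n) > 0" "Gamma (z + real n) > 0"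
      using elim assms by (auto intro!: Gamma_real_pos)
    ultimately show ?case
      by (simp add: ln_div ln_mult_pos)
  qed
  ultimately show ?thesis by (simp add: tendsto_cong)
qed

text \<open>Makes the limit independent of the offset \<open>x\<close>. Once the Gamma quotient is
  handled by Euler's limit, only an elementary expression in logarithms remains.\<close>

lemma stirling_rem_shift_LIMSEQ:
  assumes "x > 0"
  shows "(\<lambda>n. stirling_rem (x + real n) - stirling_rem (real n)) \<longlonglongrightarrow> 0"
proof -
  have "(\<lambda>n. ln (Gamma ((x + 1) + real n)) - ln (Gamma (real n)) - (x + 1) * ln (real n)) \<longlonglongrightarrow> 0"
    using assms by (intro ln_Gamma_shift_LIMSEQ) auto
  moreover have "(\<lambda>n. x * ln (real n) - (x + real n + 1 / 2) * ln (x + real n)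
      + (real n + 1 / 2) * ln (real n) + x) \<longlonglongrightarrow> 0"
    using assms by real_asymp
  ultimately have "(\<lambda>n. (ln (Gamma ((x + 1) + real n)) - ln (Gamma (real n)) - (x + 1) * ln (real n))
     + (x * ln (real n) - (x + real n + 1 / 2) * ln (x + real n)
      + (real n + 1 / 2) * ln (real n) + x)) \<longlonglongrightarrow> 0 + 0"
    by (rule tendsto_add)
  moreover have "eventually (\<lambda>n. (ln (Gamma ((x + 1) + real n)) - ln (Gamma (real n)) - (x + 1) * ln (real n))
     + (x * ln (real n) - (x + real n + 1 / 2) * ln (x + real n)
      + (real n + 1 / 2) * ln (real n) + x) = stirling_rem (x + real n) - stirling_rem (real n)) at_top"
    using eventually_gt_at_top[of 0]
  proof eventually_elim
    case (elim n)
    have "Gamma (real n + 1) = real n * Gamma (real n)"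
      using elim by (intro Gamma_plus1) (auto elim!: nonpos_Ints_cases)
    then have "ln (Gamma (real n + 1)) = ln (real n) + ln (Gamma (real n))"
      using elim by (simp add: ln_mult_pos)
    then show ?case by (simp add: stirling_rem_def algebra_simps)
  qed
  ultimately show ?thesis by (simp add: tendsto_cong)
qed

text \<open>Existence of the limit comes first, from differences of size
  \<open>O(1 / n ^ 2)\<close>. Its value then follows by comparing the sequences at
  \<open>n\<close>, \<open>n + 1 / 2\<close> and \<open>2 * n\<close>, which share that
  limit.\<close>

lemma stirling_rem_nat_LIMSEQ: "(\<lambda>n. stirling_rem (real n)) \<longlonglongrightarrow> ln (2 * pi) / 2"
proof -
  have "summable (\<lambda>n. stirling_rem (real n) - stirling_rem (real (Suc n)))"
  proof (rule summable_comparison_test_bigo)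
    show "summable (\<lambda>n. norm (1 / real n ^ 2))"
      using inverse_power_summable[of 2, where ?'a = real] by (simp add: field_simps)
    have "(\<lambda>n. (real n + 1 / 2) * (ln (real n + 1) - ln (real n)) - 1) \<in> O(\<lambda>n. 1 / real n ^ 2)"
      by real_asymp
    moreover have "eventually (\<lambda>n. stirling_rem (real n) - stirling_rem (real (Suc n)) =
      (real n + 1 / 2) * (ln (real n + 1) - ln (real n)) - 1) at_top"
      using eventually_gt_at_top[of 0]
    proof eventually_elim
      case (elim n)
      then show ?case using stirling_rem_diff[of "real n"] by (simp add: add_ac)
    qed
    ultimately show "(\<lambda>n. stirling_rem (real n) - stirling_rem (real (Suc n))) \<in> O(\<lambda>n. 1 / real n ^ 2)"
      by (simp cong: landau_o.big.in_cong)
  qed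
  then have "convergent (\<lambda>n. \<Sum>k<n. stirling_rem (real k) - stirling_rem (real (Suc k)))"
    by (simp add: summable_iff_convergent)
  \<comment> \<open>The value at 0 is just the fixed end of the telescope; the next step cancels
    it.\<close>
  then have "convergent (\<lambda>n. stirling_rem 0 - stirling_rem (real n))"
    by (simp only: sum_lessThan_telescope'[of "\<lambda>n. stirling_rem (real n)"] of_nat_0)
  then have "convergent (\<lambda>n. stirling_rem 0 - (stirling_rem 0 - stirling_rem (real n)))"
    by (rule convergent_diff[OF convergent_const])
  then obtain L where L: "(\<lambda>n. stirling_rem (real n)) \<longlonglongrightarrow> L"
    by (auto simp: convergent_def)
  have Lh: "(\<lambda>n. stirling_rem (1 / 2 + real n)) \<longlonglongrightarrow> L"
    using tendsto_add[OF stirling_rem_shift_LIMSEQ[of "1 / 2"] L] by simp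
  have L2: "(\<lambda>n. stirling_rem (real (2 * n))) \<longlonglongrightarrow> L"
    by (rule filterlim_compose[OF L]) real_asymp
  \<comment> \<open>The duplication formula evaluates this combination in closed form, which identifies \<open>L\<close>.\<close>
  have "(\<lambda>n. stirling_rem (real n) + stirling_rem (1 / 2 + real n) - stirling_rem (real (2 * n))) \<longlonglongrightarrow> L + L - L"
    by (intro tendsto_intros L Lh L2)
  moreover have "eventually (\<lambda>n. stirling_rem (real n) + stirling_rem (1 / 2 + real n) - stirling_rem (real (2 * n))
     = - (2 * real n + 1) * ln 2 + ln pi / 2 + ln (2 * real n + 1) - (real n + 1 / 2) * ln (real n) + real n
       - (real n + 1) * ln (real n + 1 / 2) + real n + 1 / 2 + (2 * real n + 1 / 2) * ln (2 * real n) - 2 * real n) at_top"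
    using eventually_gt_at_top[of 0]
  proof eventually_elim
    case (elim n)
    \<comment> \<open>Duplication at \<open>n + 1\<close> produces \<open>Gamma (2 * n + 2)\<close>,
      while \<open>stirling_rem (2 * n)\<close> contains \<open>Gamma (2 * n + 1)\<close>. The
      functional equation bridges the gap, and then all Gamma values cancel.\<close>
    have "Gamma (2 * real n + 1 + 1) = (2 * real n + 1) * Gamma (2 * real n + 1)"
      by (intro Gamma_plus1) (auto elim!: nonpos_Ints_cases)
    moreover have "Gamma (real n + 1) * Gamma (real n + 1 + 1 / 2) =
        exp ((1 - 2 * (real n + 1)) * ln 2) * sqrt pi * Gamma (2 * (real n + 1))"
      by (rule Gamma_legendre_duplication_real) simp
    ultimately have "Gamma (real n + 1) * Gamma (real n + 1 + 1 / 2) =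
        exp ((1 - 2 * (real n + 1)) * ln 2) * sqrt pi * ((2 * real n + 1) * Gamma (2 * real n + 1))"
      by (simp add: algebra_simps)
    then have "ln (Gamma (real n + 1) * Gamma (real n + 1 + 1 / 2)) =
        ln (exp ((1 - 2 * (real n + 1)) * ln 2) * sqrt pi * ((2 * real n + 1) * Gamma (2 * real n + 1)))"
      by simp
    then have "ln (Gamma (real n + 1)) + ln (Gamma (real n + 1 + 1 / 2)) =
        (1 - 2 * (real n + 1)) * ln 2 + ln pi / 2 + (ln (2 * real n + 1) + ln (Gamma (2 * real n + 1)))"
      by (simp add: ln_mult_pos ln_sqrt add_pos_nonneg)
    then show ?case
      by (simp add: stirling_rem_def algebra_simps)
  qed
  ultimately have "(\<lambda>n. - (2 * real n + 1) * ln 2 + ln pi / 2 + ln (2 * real n + 1) - (real n + 1 / 2) * ln (real n) + real n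
       - (real n + 1) * ln (real n + 1 / 2) + real n + 1 / 2 + (2 * real n + 1 / 2) * ln (2 * real n) - 2 * real n) \<longlonglongrightarrow> L"
    by (simp add: tendsto_cong)
  moreover have "(\<lambda>n. - (2 * real n + 1) * ln 2 + ln pi / 2 + ln (2 * real n + 1) - (real n + 1 / 2) * ln (real n) + real n
       - (real n + 1) * ln (real n + 1 / 2) + real n + 1 / 2 + (2 * real n + 1 / 2) * ln (2 * real n) - 2 * real n) \<longlonglongrightarrow> ln pi / 2 + ln 2 / 2"
    by real_asymp
  ultimately have "L = ln pi / 2 + ln 2 / 2" by (rule LIMSEQ_unique)
  with L show ?thesis by (simp add: ln_mult_pos add_divide_distrib add.commute)
qed

section \<open>Polygamma functions at infinity\<close>

text \<open>Shifting by \<open>n\<close> removes the first \<open>n\<close> terms of the convergent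
  series for \<open>Polygamma m z\<close>, so the shifted value is a tail of that series.\<close>

lemma Polygamma_shift_LIMSEQ:
  fixes z :: real
  assumes "z > 0" "m > 0"
  shows "(\<lambda>n. Polygamma m (z + real n)) \<longlonglongrightarrow> 0"
proof -
  have z: "z \<notin> \<int>\<^sub>\<le>\<^sub>0" using assms by (auto elim!: nonpos_Ints_cases)
  have z': "z \<noteq> - real n" for n using assms by linarith
  have "(\<lambda>k. inverse ((z + real k) ^ Suc m)) sums ((-1) ^ Suc m * Polygamma m z / fact m)"
    by (rule Polygamma_LIMSEQ) (use assms in auto)
  then have "(\<lambda>n. Polygamma m z + (-1) ^ m * fact m * (\<Sum>k<n. 1 / (z + real k) ^ Suc m)) \<longlonglongrightarrow>
      Polygamma m z + (-1) ^ m * fact m * ((-1) ^ Suc m * Polygamma m z / fact m)"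
    by (intro tendsto_intros) (simp add: sums_def field_simps)
  also have "(\<lambda>n. Polygamma m z + (-1) ^ m * fact m * (\<Sum>k<n. 1 / (z + real k) ^ Suc m)) =
      (\<lambda>n. Polygamma m (z + real n))"
    using Polygamma_plus_of_nat[of _ z m] z' by (intro ext) auto
  finally show ?thesis by (simp add: power_mult_distrib[symmetric])
qed

section \<open>The coefficients\<close>

text \<open>
  The coefficient of \<open>u ^ (2 * (i + 1))\<close> in \<open>1 / x ^ (2 * k + 1) - 1 / (x + 1) ^ (2 * k + 1)\<close> vanishes for
  \<open>k > i\<close>, so matching coefficients is a triangular linear system; this is its solution by forward
  substitution.
\<close>

fun stirling_coeff :: "nat \<Rightarrow> real" where
  "stirling_coeff i = (1 / real (2 * i + 3)
     - (\<Sum>k\<in>{1..<i}. stirling_coeff k * (4 ^ (k + 1) * real ((2 * i + 1) choose (2 * k)))))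
       / (4 ^ (i + 1) * real (2 * i + 1))"

declare stirling_coeff.simps [simp del]

text \<open>The binomial is zero for \<open>k > i\<close> and equals \<open>2 * i + 1\<close> for
  \<open>k = i\<close>, which is the source of the denominator in the recursion. Hence equation
  \<open>i\<close> is unaffected by the truncation \<open>N \<ge> i\<close>.\<close>

lemma stirling_coeff_eq:
  assumes "1 \<le> i" "i \<le> N"
  shows "(\<Sum>k=1..N. stirling_coeff k * (4 ^ (k + 1) * real ((2 * i + 1) choose (2 * k)))) = 1 / real (2 * i + 3)"
proof -
  let ?f = "\<lambda>k. stirling_coeff k * (4 ^ (k + 1) * real ((2 * i + 1) choose (2 * k)))"
  have "sum ?f {1..N} = sum ?f (insert i {1..<i})"
    using assms by (intro sum.mono_neutral_right) (auto intro!: binomial_eq_0)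
  also have "\<dots> = ?f i + sum ?f {1..<i}" by simp
  also have "?f i = 1 / real (2 * i + 3) - sum ?f {1..<i}"
    by (subst stirling_coeff.simps) simp
  finally show ?thesis by simp
qed

lemma stirling_coeff_values:
  "stirling_coeff 1 = 1 / 240" "stirling_coeff 2 = - 11 / 6720"
  "stirling_coeff 3 = 107 / 80640" "stirling_coeff 4 = - 2911 / 1520640"
proof -
  have s: "{1..<1::nat} = {}" "{1..<2::nat} = {1}" "{1..<3::nat} = {1,2}" "{1..<4::nat} = {1,2,3}"
    by auto
  show 1: "stirling_coeff 1 = 1 / 240"
    by (subst stirling_coeff.simps, subst s) (simp add: eval_nat_numeral)
  then have 1: "stirling_coeff (Suc 0) = 1 / 240" by simp
  show 2: "stirling_coeff 2 = - 11 / 6720"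
    by (subst stirling_coeff.simps, subst s) (simp add: 1 binomial_code fold_atLeastAtMost_nat.simps fact_numeral)
  show 3: "stirling_coeff 3 = 107 / 80640"
    by (subst stirling_coeff.simps, subst s) (simp add: 1 2 binomial_code fold_atLeastAtMost_nat.simps fact_numeral)
  show 4: "stirling_coeff 4 = - 2911 / 1520640"
    by (subst stirling_coeff.simps, subst s) (simp add: 1 2 3 binomial_code fold_atLeastAtMost_nat.simps fact_numeral)
qed

section \<open>The remainder after \<open>N\<close> terms\<close>

text \<open>The trigamma function is written as \<open>Polygamma 1\<close>, whose recurrence and
  series are used; it is matched with \<open>deriv Digamma\<close> at the very end.\<close>

definition trigamma_stirling_rem :: "nat \<Rightarrow> real \<Rightarrow> real" where
  "trigamma_stirling_rem N x = stirling_rem x - ln (2 * pi) / 2 - Polygamma 1 (x + 1 / 2) / 12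
     - (\<Sum>k=1..N. stirling_coeff k / x ^ (2 * k + 1))"

lemma trigamma_stirling_rem_LIMSEQ:
  assumes "x > 0"
  shows "(\<lambda>n. trigamma_stirling_rem N (x + real n)) \<longlonglongrightarrow> 0"
proof -
  have "(\<lambda>n. stirling_rem (x + real n)) \<longlonglongrightarrow> ln (2 * pi) / 2"
    using tendsto_add[OF stirling_rem_shift_LIMSEQ[OF assms] stirling_rem_nat_LIMSEQ] by simp
  moreover have "(\<lambda>n. Polygamma 1 (x + real n + 1 / 2)) \<longlonglongrightarrow> 0"
    using Polygamma_shift_LIMSEQ[of "x + 1 / 2" 1] assms by (simp add: add_ac)
  moreover have "(\<lambda>n. stirling_coeff k / (x + real n) ^ (2 * k + 1)) \<longlonglongrightarrow> 0" for k
    by (intro tendsto_divide_0[OF tendsto_const] filterlim_at_top_imp_at_infinity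
          filterlim_pow_at_top) (use assms in \<open>auto, real_asymp\<close>)
  ultimately have "(\<lambda>n. trigamma_stirling_rem N (x + real n)) \<longlonglongrightarrow>
      ln (2 * pi) / 2 - ln (2 * pi) / 2 - 0 / 12 - (\<Sum>k=1..N. 0)"
    unfolding trigamma_stirling_rem_def by (intro tendsto_intros) auto
  then show ?thesis by simp
qed

lemma sums_trigamma_stirling_rem_diff:
  assumes "x > 0"
  shows "(\<lambda>i. ((if i = 0 then 0 else 1 / real (2 * i + 3))
            - (\<Sum>k=1..N. stirling_coeff k * (4 ^ (k + 1) * real ((2 * i + 1) choose (2 * k)))))
           * (1 / (2 * x + 1)\<^sup>2) ^ (i + 1))
         sums (trigamma_stirling_rem N x - trigamma_stirling_rem N (x + 1))"
proof -
  let ?w = "1 / (2 * x + 1)\<^sup>2"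
  \<comment> \<open>This is where the weight 1/12 and the shift 1/2 come from: the trigamma
    difference is exactly \<open>4 * u\<^sup>2\<close>, and a twelfth of it is the leading term
    \<open>u\<^sup>2 / 3\<close> of the Stirling difference.\<close>
  have "Polygamma 1 (x + 1 / 2 + 1) = Polygamma 1 (x + 1 / 2) - 1 / (x + 1 / 2)\<^sup>2"
    using Polygamma_plus1[of "x + 1 / 2" 1] assms by (simp add: eval_nat_numeral)
  moreover have "1 / (x + 1 / 2)\<^sup>2 = 4 * ?w"
    using assms by (simp add: field_simps power2_eq_square)
  ultimately have pg: "Polygamma 1 (x + 1 / 2) - Polygamma 1 (x + 1 + 1 / 2) = 4 * ?w"
    by (simp add: add_ac)
  have "(\<lambda>i. if i = 0 then (1 / 3) * ?w else 0) sums ((1 / 3) * ?w)"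
    using sums_single[of 0 "\<lambda>_. (1 / 3) * ?w"] by simp
  moreover have "(\<lambda>i. \<Sum>k=1..N. stirling_coeff k *
       (4 ^ (k + 1) * real ((2 * i + 1) choose (2 * k)) * ?w ^ (i + 1)))
     sums (\<Sum>k=1..N. stirling_coeff k * (1 / x ^ (2 * k + 1) - 1 / (x + 1) ^ (2 * k + 1)))"
    by (intro sums_sum sums_mult sums_diff_inverse_odd_power assms)
  ultimately have "(\<lambda>i. 1 / real (2 * i + 3) * ?w ^ (i + 1) - (if i = 0 then (1 / 3) * ?w else 0)
      - (\<Sum>k=1..N. stirling_coeff k * (4 ^ (k + 1) * real ((2 * i + 1) choose (2 * k)) * ?w ^ (i + 1))))
     sums ((x + 1 / 2) * (ln (x + 1) - ln x) - 1 - (1 / 3) * ?w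
       - (\<Sum>k=1..N. stirling_coeff k * (1 / x ^ (2 * k + 1) - 1 / (x + 1) ^ (2 * k + 1))))"
    by (intro sums_diff sums_stirling_diff assms)
  also have "(\<lambda>i. 1 / real (2 * i + 3) * ?w ^ (i + 1) - (if i = 0 then (1 / 3) * ?w else 0)
      - (\<Sum>k=1..N. stirling_coeff k * (4 ^ (k + 1) * real ((2 * i + 1) choose (2 * k)) * ?w ^ (i + 1))))
     = (\<lambda>i. ((if i = 0 then 0 else 1 / real (2 * i + 3))
            - (\<Sum>k=1..N. stirling_coeff k * (4 ^ (k + 1) * real ((2 * i + 1) choose (2 * k)))))
           * ?w ^ (i + 1))" (is "?L = ?R")
  proof
    fix i
    have "(\<Sum>k=1..N. stirling_coeff k * (4 ^ (k + 1) * real ((2 * i + 1) choose (2 * k)) * ?w ^ (i + 1)))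
        = (\<Sum>k=1..N. stirling_coeff k * (4 ^ (k + 1) * real ((2 * i + 1) choose (2 * k)))) * ?w ^ (i + 1)"
      by (simp only: sum_distrib_right mult.assoc)
    moreover have "1 / real (2 * i + 3) * ?w ^ (i + 1) - (if i = 0 then (1 / 3) * ?w else 0)
        = (if i = 0 then 0 else 1 / real (2 * i + 3)) * ?w ^ (i + 1)"
      by (cases "i = 0") (simp, simp only: if_False diff_0_right)
    ultimately show "?L i = ?R i" by (simp only: left_diff_distrib)
  qed
  also have "(x + 1 / 2) * (ln (x + 1) - ln x) - 1 - (1 / 3) * ?w
       - (\<Sum>k=1..N. stirling_coeff k * (1 / x ^ (2 * k + 1) - 1 / (x + 1) ^ (2 * k + 1)))
     = trigamma_stirling_rem N x - trigamma_stirling_rem N (x + 1)"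
  proof -
    \<comment> \<open>The regrouping is linear, so it is proved for abstract quantities, given only
      the Stirling and trigamma differences.\<close>
    have "A - (1 / 3) * w - (a - b) = (s - l - p / 12 - a) - (s' - l - p' / 12 - b)"
      if "s - s' = A" "p - p' = 4 * w" for A w a b s s' l p p' :: real
      using that by linarith
    moreover have "(\<Sum>k=1..N. stirling_coeff k * (1 / x ^ (2 * k + 1) - 1 / (x + 1) ^ (2 * k + 1)))
      = (\<Sum>k=1..N. stirling_coeff k / x ^ (2 * k + 1)) - (\<Sum>k=1..N. stirling_coeff k / (x + 1) ^ (2 * k + 1))"
      by (simp only: right_diff_distrib sum_subtractf times_divide_eq_right mult_1_right)
    ultimately show ?thesis
      unfolding trigamma_stirling_rem_def using stirling_rem_diff[OF assms] pg by presburger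
  qed
  finally show ?thesis .
qed

text \<open>All coefficients with \<open>i \<le> N\<close> vanish: for \<open>i = 0\<close> by the
  trigamma term, for the others by the choice of \<open>stirling_coeff\<close>. The series thus
  starts at exponent \<open>N + 2\<close>.\<close>

lemma trigamma_stirling_rem_diff_bound:
  obtains K where "K \<ge> 0"
    "\<And>x. x \<ge> 1 \<Longrightarrow> \<bar>trigamma_stirling_rem N x - trigamma_stirling_rem N (x + 1)\<bar>
        \<le> K * (1 / (2 * x + 1)\<^sup>2) ^ (N + 2)"
proof -
  define e where "e = (\<lambda>i. (if i = 0 then 0 else 1 / real (2 * i + 3))
            - (\<Sum>k=1..N. stirling_coeff k * (4 ^ (k + 1) * real ((2 * i + 1) choose (2 * k)))))"
  have sums: "(\<lambda>i. e i * (1 / (2 * x + 1)\<^sup>2) ^ (i + 1)) sums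
      (trigamma_stirling_rem N x - trigamma_stirling_rem N (x + 1))" if "x > 0" for x
    using sums_trigamma_stirling_rem_diff[OF that, of N] by (simp only: e_def)
  \<comment> \<open>Dividing by \<open>1 / (2 * x + 1)\<^sup>2\<close> aligns the exponent with the
    index; the lost factor returns as the step from \<open>N + 1\<close> to
    \<open>N + 2\<close>.\<close>
  have sums': "(\<lambda>i. e i * (1 / (2 * x + 1)\<^sup>2) ^ i) sums
      ((trigamma_stirling_rem N x - trigamma_stirling_rem N (x + 1)) * (2 * x + 1)\<^sup>2)" if "x > 0" for x
    using sums_mult2[OF sums[OF that], of "(2 * x + 1)\<^sup>2"] that by (simp add: field_simps)
  \<comment> \<open>The radius 1/4 is the value of \<open>1 / (2 * x + 1)\<^sup>2\<close> at
    \<open>x = 1 / 2\<close>, and the smaller 1/9 below is its value at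
    \<open>x = 1\<close>.\<close>
  have "summable (\<lambda>i. e i * (1 / 4) ^ i)"
    using sums'[of "1 / 2"] by (simp add: sums_iff)
  moreover have "e i = 0" if "i < N + 1" for i
  proof (cases "i = 0")
    case True
    have "(\<Sum>k=1..N. stirling_coeff k * (4 ^ (k + 1) * real ((2 * i + 1) choose (2 * k)))) = 0"
      using True by (intro sum.neutral) (auto simp: binomial_eq_0)
    with True show ?thesis by (simp only: e_def if_True refl diff_0_right)
  next
    case False
    then show ?thesis using stirling_coeff_eq[of i N] that by (simp add: e_def)
  qed
  ultimately obtain K where K: "K \<ge> 0"
      "\<And>w. 0 \<le> w \<Longrightarrow> w \<le> 1 / 9 \<Longrightarrow> \<bar>\<Sum>n. e n * w ^ n\<bar> \<le> K * w ^ (N + 1)"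
    using powser_tail_bound[of e "1 / 4" "1 / 9" "N + 1"] by auto
  show ?thesis
  proof (rule that[OF K(1)])
    fix x :: real assume x: "x \<ge> 1"
    define w where "w = 1 / (2 * x + 1)\<^sup>2"
    have "3\<^sup>2 \<le> (2 * x + 1)\<^sup>2" using x by (intro power_mono) auto
    then have w: "0 < w" "w \<le> 1 / 9" using x by (auto simp: w_def field_simps)
    have "(\<Sum>n. e n * w ^ n) = (trigamma_stirling_rem N x - trigamma_stirling_rem N (x + 1)) / w"
      using sums'[of x] x by (simp add: sums_iff w_def)
    with K(2)[of w] w have "\<bar>trigamma_stirling_rem N x - trigamma_stirling_rem N (x + 1)\<bar> / w \<le> K * w ^ (N + 1)"
      by (simp add: abs_divide)
    with w show "\<bar>trigamma_stirling_rem N x - trigamma_stirling_rem N (x + 1)\<bar> \<le> K * w ^ (N + 2)"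
      by (simp add: field_simps)
  qed
qed

text \<open>The series for the right-hand side has nonnegative terms, so it is at least its term
  \<open>i = k\<close>, whose coefficient \<open>4 ^ (k + 1) * (2 * k + 1)\<close> is at least
  1.\<close>

lemma diff_inverse_odd_power_ge:
  fixes x :: real
  assumes "x > 0"
  shows "(1 / (2 * x + 1)\<^sup>2) ^ (k + 1) \<le> 1 / x ^ (2 * k + 1) - 1 / (x + 1) ^ (2 * k + 1)"
proof -
  let ?f = "\<lambda>i. 4 ^ (k + 1) * real ((2 * i + 1) choose (2 * k)) * (1 / (2 * x + 1)\<^sup>2) ^ (i + 1)"
  have s: "?f sums (1 / x ^ (2 * k + 1) - 1 / (x + 1) ^ (2 * k + 1))"
    by (rule sums_diff_inverse_odd_power[OF assms])
  have "1 * (1 / (2 * x + 1)\<^sup>2) ^ (k + 1) \<le> 4 ^ (k + 1) * real (2 * k + 1) * (1 / (2 * x + 1)\<^sup>2) ^ (k + 1)"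
    by (intro mult_right_mono mult_ge1_I one_le_power) auto
  also have "\<dots> = sum ?f {k}" by simp
  also have "\<dots> \<le> suminf ?f"
    using s by (intro sum_le_suminf) (auto simp: sums_iff)
  finally show ?thesis using s by (simp add: sums_iff)
qed

lemma trigamma_stirling_rem_bigo:
  "trigamma_stirling_rem N \<in> O[at_top](\<lambda>x. 1 / x ^ (2 * N + 3))"
proof -
  obtain K where K: "K \<ge> 0"
    "\<And>x. x \<ge> 1 \<Longrightarrow> \<bar>trigamma_stirling_rem N x - trigamma_stirling_rem N (x + 1)\<bar>
        \<le> K * (1 / (2 * x + 1)\<^sup>2) ^ (N + 2)"
    using trigamma_stirling_rem_diff_bound by blast
  have "\<bar>trigamma_stirling_rem N x\<bar> \<le> K * (1 / x ^ (2 * N + 3))" if x: "x \<ge> 1" for x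
  proof (rule abs_le_of_telescoping_bound[where V = "\<lambda>x. 1 / x ^ (2 * N + 3)"])
    fix y assume y: "y \<ge> x"
    \<comment> \<open>The comparison at \<open>k = N + 1\<close> matches the exponent
      \<open>N + 2\<close> of the difference bound, so the same \<open>K\<close> serves for the
      remainder.\<close>
    have "(1 / (2 * y + 1)\<^sup>2) ^ (N + 2) \<le> 1 / y ^ (2 * N + 3) - 1 / (y + 1) ^ (2 * N + 3)"
      using diff_inverse_odd_power_ge[of y "N + 1"] x y by (simp add: numeral_3_eq_3)
    then have "K * (1 / (2 * y + 1)\<^sup>2) ^ (N + 2) \<le> K * (1 / y ^ (2 * N + 3) - 1 / (y + 1) ^ (2 * N + 3))"
      using K(1) by (rule mult_left_mono)
    with K(2)[of y] x y
    show "\<bar>trigamma_stirling_rem N y - trigamma_stirling_rem N (y + 1)\<bar> \<le>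
      K * (1 / y ^ (2 * N + 3) - 1 / (y + 1) ^ (2 * N + 3))"
      by linarith
  next
    fix y assume "y \<ge> x"
    with x show "0 \<le> 1 / y ^ (2 * N + 3)" by simp
  next
    show "(\<lambda>n. trigamma_stirling_rem N (x + real n)) \<longlonglongrightarrow> 0"
      by (rule trigamma_stirling_rem_LIMSEQ) (use x in simp)
  qed (fact K(1))
  then have "eventually (\<lambda>x. norm (trigamma_stirling_rem N x) \<le> K * norm (1 / x ^ (2 * N + 3))) at_top"
    by (intro eventually_mono[OF eventually_ge_at_top[of "1 :: real"]]) simp
  then show ?thesis by (rule bigoI)
qed

theorem theorem3p1:
  shows "\<exists>c :: nat \<Rightarrow> real.
    c 1 = 1 / 240 \<and> c 2 = - 11 / 6720 \<and> c 3 = 107 / 80640 \<and> c 4 = - 2911 / 1520640 \<and>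
    (\<forall>N \<ge> 1.
      (\<lambda>x :: real.
        (ln (Gamma (x + 1)) - (x + 1 / 2) * ln x + x - 1 / 2 * ln (2 * pi)
          - 1 / 12 * deriv Digamma (x + 1 / 2))
        - (\<Sum>k = 1..N. c k / x ^ (2 * k + 1)))
      \<in> O[at_top](\<lambda>x. 1 / x ^ (2 * N + 3)))"
proof (intro exI[of _ stirling_coeff] conjI allI impI stirling_coeff_values)
  fix N :: nat
  \<comment> \<open>For \<open>x > 0\<close> the point \<open>x + 1 / 2\<close> is not a pole, so
    there the derivative of \<open>Digamma\<close> is \<open>Polygamma 1\<close>; agreement for
    large \<open>x\<close> suffices for the O-estimate.\<close>
  have "eventually (\<lambda>x. trigamma_stirling_rem N x =
     (ln (Gamma (x + 1)) - (x + 1 / 2) * ln x + x - 1 / 2 * ln (2 * pi)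
          - 1 / 12 * deriv Digamma (x + 1 / 2))
        - (\<Sum>k = 1..N. stirling_coeff k / x ^ (2 * k + 1))) at_top"
    using eventually_gt_at_top[of 0]
  proof eventually_elim
    case (elim x)
    have "deriv Digamma (x + 1 / 2) = Polygamma 1 (x + 1 / 2)"
      using elim by (subst deriv_Polygamma) (auto elim!: nonpos_Ints_cases)
    then show ?case by (simp add: trigamma_stirling_rem_def stirling_rem_def)
  qed
  from landau_o.big.in_cong[OF this] trigamma_stirling_rem_bigo[of N]
  show "(\<lambda>x. (ln (Gamma (x + 1)) - (x + 1 / 2) * ln x + x - 1 / 2 * ln (2 * pi)
          - 1 / 12 * deriv Digamma (x + 1 / 2))
        - (\<Sum>k = 1..N. stirling_coeff k / x ^ (2 * k + 1)))
      \<in> O[at_top](\<lambda>x. 1 / x ^ (2 * N + 3))"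
    by (rule iffD1)
qed

end
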